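(* Let $b\ge 2$ be an integer, let $f(n,k)$ be a function (with, say, complex values) defined for integers $0\le k\le n$, and let $S(n):=\sum_{k=0}^{n} f(n,k)$. Let $n$ be a nonnegative integer with base-$b$ expansion $n=\sum_{i=0}^{N-1}n_i b^i$. Then $$\prod_{i=0}^{N-1}S(n_i) = \sum_{0\leq k \leq_b n}\ \prod_{i=0}^{N-1}f(n_i, k_i).$$
   Context: Base-$b$ digits satisfy $0\le n_i\le b-1$, and $N$ is the number of base-$b$ digits of $n$. For a nonnegative integer $k$ with base-$b$ expansion $k=\sum_i k_i b^i$ (padded with zeros), the relation $k\leq_b n$ (digital dominance) means $k_i\le n_i$ for every $i$. The sum is over all integers $k\ge 0$ with $k\le_b n$; each such $k$ is written with $N$ digits $k_0,\dots,k_{N-1}$. *)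

theory Defs
  imports Complex_Main "HOL-Library.Log_Nat"
begin

definition digit :: "nat \<Rightarrow> nat \<Rightarrow> nat \<Rightarrow> nat" where
  "digit b n i = n div b ^ i mod b"

(* floorlog b n is the number of base-b digits for n > 0 but is 0 at n = 0;
   the number 0 is written with the single digit 0. *)
definition num_digits :: "nat \<Rightarrow> nat \<Rightarrow> nat" where
  "num_digits b n = max 1 (floorlog b n)"

definition digit_dominated :: "nat \<Rightarrow> nat \<Rightarrow> nat \<Rightarrow> bool" where
  "digit_dominated b k n \<longleftrightarrow> (\<forall>i. digit b k i \<le> digit b n i)"

lemma sum_digits_mod: "(\<Sum>i<N. digit b n i * b ^ i) = n mod b ^ N"
proof (induction N)
  case (Suc N)
  have "n mod (b ^ N * b) = b ^ N * (n div b ^ N mod b) + n mod b ^ N"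
    by (rule mod_mult2_eq)
  with Suc show ?case
    by (simp add: digit_def mult.commute)
qed simp

lemma less_power_num_digits:
  assumes "b \<ge> 2" shows "n < b ^ num_digits b n"
  using assms floorlog_leD[of b n "num_digits b n"] by (simp add: num_digits_def)

lemma sum_digits:
  assumes "b \<ge> 2" shows "(\<Sum>i<num_digits b n. digit b n i * b ^ i) = n"
  using less_power_num_digits[OF assms, of n] by (simp add: sum_digits_mod)

lemma digit_dominated_imp_le:
  assumes "b \<ge> 2" "digit_dominated b k n" shows "k \<le> n"
proof -
  define N where "N = max (num_digits b k) (num_digits b n)"
  have "b ^ num_digits b k \<le> b ^ N" "b ^ num_digits b n \<le> b ^ N"
    using assms(1) by (auto intro!: power_increasing simp: N_def)
  then have "k < b ^ N" "n < b ^ N"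
    using less_power_num_digits[OF assms(1)] by (meson less_le_trans)+
  moreover have "(\<Sum>i<N. digit b k i * b ^ i) \<le> (\<Sum>i<N. digit b n i * b ^ i)"
    using assms(2) by (intro sum_mono mult_right_mono) (auto simp: digit_dominated_def)
  ultimately show ?thesis
    by (simp add: sum_digits_mod)
qed

(* The sum over all dominated k is therefore a genuine finite sum. *)
lemma finite_digit_dominated:
  assumes "b \<ge> 2" shows "finite {k. digit_dominated b k n}"
  using digit_dominated_imp_le[OF assms] by (auto intro: finite_subset[of _ "{..n}"])

end

theory Submission
  imports Defs
begin

text \<open>Expanding the product of the digit sums selects one digit at each position; with exactly
  those digits there is one number \<open>k\<close>. The induction on the number of positions
  splits off the leading digit.\<close>

text \<open>For \<open>b > 0\<close>, the added term is a multiple of \<open>b ^ Suc i\<close>, so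
  after division by \<open>b ^ i\<close> it is a multiple of \<open>b\<close> and vanishes modulo
  \<open>b\<close>.\<close>

lemma digit_add_mult_power_less:
  assumes "i < N"
  shows "digit b (k + d * b ^ N) i = digit b k i"
proof (cases "b = 0")
  case False
  from assms obtain j where N: "N = i + Suc j"
    using less_iff_Suc_add by auto
  have "(k + d * b ^ N) div b ^ i = k div b ^ i + d * b ^ j * b"
    using False div_mult_self2[of "b ^ i" k "d * b ^ Suc j"]
    by (simp add: N power_add algebra_simps)
  then show ?thesis
    by (simp add: digit_def)
\<comment> \<open>For \<open>b = 0\<close>: at \<open>i = 0\<close> the added term is zero because
  \<open>N > 0\<close>; at later positions division by zero makes both digits 0.\<close>
qed (use assms in \<open>cases i; simp add: digit_def\<close>)

lemma digit_add_mult_power_eq: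
  assumes "k < b ^ N" "d < b"
  shows "digit b (k + d * b ^ N) N = d"
  using assms by (simp add: digit_def)

text \<open>The bounds \<open>m\<close> are independent of \<open>N\<close>, which lets the
  induction run. Since \<open>m i < b\<close>, every choice \<open>d \<le> m i\<close> is a
  legitimate digit.\<close>

lemma prod_sum_digits:
  fixes g :: "nat \<Rightarrow> nat \<Rightarrow> 'a :: comm_semiring_1"
  assumes m: "\<And>i. m i < b"
  shows "(\<Prod>i<N. \<Sum>d\<le>m i. g i d)
       = (\<Sum>k | k < b ^ N \<and> (\<forall>i<N. digit b k i \<le> m i). \<Prod>i<N. g i (digit b k i))"
proof (induction N)
  case 0
  have "{k. k < b ^ 0 \<and> (\<forall>i<0. digit b k i \<le> m i)} = {0}"
    by auto
  then show ?case by simp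
next
  case (Suc N)
  define A where "A N = {k. k < b ^ N \<and> (\<forall>i<N. digit b k i \<le> m i)}" for N
  have "b > 0"
    using m[of 0] by simp
  have "(\<Prod>i<Suc N. \<Sum>d\<le>m i. g i d)
      = (\<Sum>(k, d)\<in>A N \<times> {..m N}. (\<Prod>i<N. g i (digit b k i)) * g N d)"
    using Suc by (simp add: A_def sum_product sum.cartesian_product)
  also have "\<dots> = (\<Sum>k\<in>A (Suc N). \<Prod>i<Suc N. g i (digit b k i))"
  \<comment> \<open>The pair \<open>(k, d)\<close> becomes the number with leading digit
    \<open>d\<close> at position \<open>N\<close> above the digits of \<open>k\<close>; remainder
    and quotient by \<open>b ^ N\<close> recover the pair.\<close>
  proof (rule sum.reindex_bij_witness
      [where i = "\<lambda>k. (k mod b ^ N, k div b ^ N)" and j = "\<lambda>(k, d). k + d * b ^ N"])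
    fix p assume "p \<in> A N \<times> {..m N}"
    then obtain k d where p: "p = (k, d)" and k: "k < b ^ N" "\<And>i. i < N \<Longrightarrow> digit b k i \<le> m i"
      and d: "d \<le> m N"
      by (auto simp: A_def)
    have "d < b"
      using d m[of N] by simp
    note digits = digit_add_mult_power_less digit_add_mult_power_eq[OF k(1) \<open>d < b\<close>]
    show "((case p of (k, d) \<Rightarrow> k + d * b ^ N) mod b ^ N, (case p of (k, d) \<Rightarrow> k + d * b ^ N) div b ^ N) = p"
      using k(1) \<open>b > 0\<close> by (simp add: p)
    have "k + d * b ^ N < Suc d * b ^ N"
      using k(1) by simp
    also have "\<dots> \<le> b * b ^ N"
      using \<open>d < b\<close> by (intro mult_right_mono) auto
    finally show "(case p of (k, d) \<Rightarrow> k + d * b ^ N) \<in> A (Suc N)"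
      using k(2) d by (auto simp: A_def p less_Suc_eq digits)
    show "(\<Prod>i<Suc N. g i (digit b (case p of (k, d) \<Rightarrow> k + d * b ^ N) i))
        = (case p of (k, d) \<Rightarrow> (\<Prod>i<N. g i (digit b k i)) * g N d)"
      by (simp add: p digits)
  next
    fix k assume k: "k \<in> A (Suc N)"
    show "(case (k mod b ^ N, k div b ^ N) of (k, d) \<Rightarrow> k + d * b ^ N) = k"
      by (simp add: mod_div_mult_eq)
    \<comment> \<open>As the quotient is below \<open>b\<close>, reduction modulo \<open>b\<close>
      leaves it unchanged, so it is the top digit.\<close>
    have "k div b ^ N < b"
      using k by (simp add: A_def less_mult_imp_div_less)
    then have "k div b ^ N = digit b k N"
      by (simp add: digit_def)
    moreover have "digit b (k mod b ^ N) i = digit b k i" if "i < N" for i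
      using digit_add_mult_power_less[OF that, of b "k mod b ^ N" "k div b ^ N"] by (simp add: mod_div_mult_eq)
    ultimately show "(k mod b ^ N, k div b ^ N) \<in> A N \<times> {..m N}"
      using k \<open>b > 0\<close> by (simp add: A_def)
  qed
  finally show ?case
    by (simp add: A_def)
qed

text \<open>Beyond the digits of \<open>n\<close>, dominance forces the digits of \<open>k\<close>
  to be zero; the bound on \<open>k\<close> encodes this and gives the index set of
  \<open>prod_sum_digits\<close>.\<close>

lemma digit_dominated_iff:
  assumes "b \<ge> 2"
  shows "digit_dominated b k n \<longleftrightarrow>
    k < b ^ num_digits b n \<and> (\<forall>i<num_digits b n. digit b k i \<le> digit b n i)"
proof
  assume "digit_dominated b k n"
  then show "k < b ^ num_digits b n \<and> (\<forall>i<num_digits b n. digit b k i \<le> digit b n i)"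
    using digit_dominated_imp_le[OF assms] less_power_num_digits[OF assms, of n]
    by (meson digit_dominated_def le_less_trans)
next
  assume k: "k < b ^ num_digits b n \<and> (\<forall>i<num_digits b n. digit b k i \<le> digit b n i)"
  have "digit b k i = 0" if "i \<ge> num_digits b n" for i
  proof -
    have "b ^ num_digits b n \<le> b ^ i"
      using that assms by (intro power_increasing) auto
    then show ?thesis
      using k by (simp add: digit_def)
  qed
  then show "digit_dominated b k n"
    using k unfolding digit_dominated_def by (metis le0 not_le)
qed

theorem theorem1:
  fixes b :: nat and f :: "nat \<Rightarrow> nat \<Rightarrow> complex" and S :: "nat \<Rightarrow> complex" and n :: nat
  assumes b: "b \<ge> 2"
    and S: "\<And>m. S m = (\<Sum>k=0..m. f m k)"
  shows "(\<Prod>i<num_digits b n. S (digit b n i))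
       = (\<Sum>k | digit_dominated b k n. \<Prod>i<num_digits b n. f (digit b n i) (digit b k i))"
proof -
  have "digit b n i < b" for i
    using b by (simp add: digit_def)
  \<comment> \<open>The weight \<open>g i d\<close> may depend on the position, so it can be matched
    with \<open>f (digit b n i) d\<close>.\<close>
  from prod_sum_digits[of "digit b n", OF this] show ?thesis
    by (simp add: S digit_dominated_iff[OF b] atMost_atLeast0)
qed

end
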